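(* A reduced centralizer unfolding of $L$ is given by $L_r:\mathbb{R}^5\to\mathfrak{gl}(4,\mathbb{R})$, $$L_r(\nu)=L+\nu_1M_1+\nu_2M_4+\nu_3M_6+\nu_4M_8+\nu_5M_5.$$ That is, for every element $A=L+\sum_{i=1}^8\mu_iM_i$ ($\mu\in\mathbb{R}^8$) of the centralizer unfolding of $L$ there are $g\in\mathrm{Gl}_L(4,\mathbb{R})$ and $\nu\in\mathbb{R}^5$ such that $g^{-1}Ag=L_r(\nu)$.
   Context: Let $I=\begin{pmatrix}1&0\\0&1\end{pmatrix}$, $R=\begin{pmatrix}1&0\\0&-1\end{pmatrix}$, $T=\begin{pmatrix}0&1\\1&0\end{pmatrix}$, $J=\begin{pmatrix}0&1\\-1&0\end{pmatrix}$, and (in $2\times2$ blocks) $M_1=\begin{pmatrix}I&0\\0&I\end{pmatrix}$, $M_2=\begin{pmatrix}R&0\\0&R\end{pmatrix}$, $M_3=\begin{pmatrix}T&0\\0&T\end{pmatrix}$, $M_4=\begin{pmatrix}0&J\\-J&0\end{pmatrix}$, $M_5=L=\begin{pmatrix}0&I\\-I&0\end{pmatrix}$, $M_6=\begin{pmatrix}0&R\\-R&0\end{pmatrix}$, $M_7=\begin{pmatrix}0&T\\-T&0\end{pmatrix}$, $M_8=\begin{pmatrix}J&0\\0&J\end{pmatrix}$. The centralizer unfolding of $L$ is $\{L+\sum_{i=1}^8\mu_iM_i : \mu\in\mathbb{R}^8\}$. The group $\mathrm{Gl}_L(4,\mathbb{R})=\{g\in\mathrm{Gl}(4,\mathbb{R})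 : gL=Lg\}$ acts on it by $A\mapsto g^{-1}Ag$. A reduced (centralizer) unfolding is a sub-family of the centralizer unfolding with fewer parameters such that each element of the centralizer unfolding is equivalent, under this action (with $g$ allowed to depend on the parameters), to an element of the reduced one. *)

theory Defs
  imports "HOL-Analysis.Analysis"
begin

definition matR :: "real^2^2" where
  "matR = vector [vector [1, 0], vector [0, -1]]"

definition matT :: "real^2^2" where
  "matT = vector [vector [0, 1], vector [1, 0]]"

definition matJ :: "real^2^2" where
  "matJ = vector [vector [0, 1], vector [-1, 0]]"

text \<open>\<^term>\<open>block A B C D\<close> has first block row \<open>A B\<close> and second block row \<open>C D\<close>.\<close>

definition block :: "real^2^2 \<Rightarrow> real^2^2 \<Rightarrow> real^2^2 \<Rightarrow> real^2^2 \<Rightarrow> real^4^4" where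
  "block A B C D = vector
     [vector [A$1$1, A$1$2, B$1$1, B$1$2],
      vector [A$2$1, A$2$2, B$2$1, B$2$2],
      vector [C$1$1, C$1$2, D$1$1, D$1$2],
      vector [C$2$1, C$2$2, D$2$1, D$2$2]]"

definition M1 :: "real^4^4" where "M1 = block (mat 1) 0 0 (mat 1)"
definition M2 :: "real^4^4" where "M2 = block matR 0 0 matR"
definition M3 :: "real^4^4" where "M3 = block matT 0 0 matT"
definition M4 :: "real^4^4" where "M4 = block 0 matJ (- matJ) 0"
definition M5 :: "real^4^4" where "M5 = block 0 (mat 1) (- mat 1) 0"
definition M6 :: "real^4^4" where "M6 = block 0 matR (- matR) 0"
definition M7 :: "real^4^4" where "M7 = block 0 matT (- matT) 0"
definition M8 :: "real^4^4" where "M8 = block matJ 0 0 matJ"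

abbreviation matL :: "real^4^4" where "matL \<equiv> M5"

definition centralizer_unfolding :: "real^8 \<Rightarrow> real^4^4" where
  "centralizer_unfolding \<mu> = matL
     + \<mu>$1 *\<^sub>R M1 + \<mu>$2 *\<^sub>R M2 + \<mu>$3 *\<^sub>R M3 + \<mu>$4 *\<^sub>R M4
     + \<mu>$5 *\<^sub>R M5 + \<mu>$6 *\<^sub>R M6 + \<mu>$7 *\<^sub>R M7 + \<mu>$8 *\<^sub>R M8"

definition Gl_L :: "(real^4^4) set" where
  "Gl_L = {g. invertible g \<and> g ** matL = matL ** g}"

definition Gl_L_equivalent :: "real^4^4 \<Rightarrow> real^4^4 \<Rightarrow> bool" where
  "Gl_L_equivalent A B \<longleftrightarrow> (\<exists>g\<in>Gl_L. matrix_inv g ** A ** g = B)"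

text \<open>
  A sub-family with fewer parameters is the restriction of the centralizer unfolding to a
  linear subspace of its parameter space of dimension less than 8, parametrized by an
  injective linear map. A merely set-theoretic inclusion of ranges would not give
  ``fewer parameters'' any content, because \<open>\<real>\<^sup>8\<close> and \<open>\<real>\<close> are equinumerous.
\<close>

definition reduced_centralizer_unfolding :: "(real^'k \<Rightarrow> real^4^4) \<Rightarrow> bool" where
  "reduced_centralizer_unfolding F \<longleftrightarrow>
     CARD('k) < 8 \<and>
     (\<exists>P :: real^'k \<Rightarrow> real^8. linear P \<and> inj P \<and>
        (\<forall>\<nu>. F \<nu> = centralizer_unfolding (P \<nu>))) \<and>
     (\<forall>\<mu>. \<exists>\<nu>. Gl_L_equivalent (centralizer_unfolding \<mu>) (F \<nu>))"

definition L_r :: "real^5 \<Rightarrow> real^4^4" where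
  "L_r \<nu> = matL
     + \<nu>$1 *\<^sub>R M1 + \<nu>$2 *\<^sub>R M4 + \<nu>$3 *\<^sub>R M6 + \<nu>$4 *\<^sub>R M8 + \<nu>$5 *\<^sub>R M5"

end

theory Submission
  imports Defs
begin

text \<open>
  Since \<open>L\<^sup>2 = - 1\<close>, the matrix \<open>L\<close> is a complex structure on \<open>\<real>\<^sup>4\<close>, and the real \<open>4 \<times> 4\<close> matrices
  commuting with it are the complex \<open>2 \<times> 2\<close> matrices: \<open>A + i B\<close> corresponds to the block matrix
  with rows \<open>A B\<close> and \<open>-B A\<close>, and \<open>L\<close> itself to multiplication by \<open>i\<close>. Under this identification
  \<open>Gl_L\<close> is \<open>GL(2,\<complex>)\<close>, acting by conjugation, and \<open>M1\<close>, \<open>M5\<close>; \<open>M2\<close>, \<open>M6\<close>; \<open>M3\<close>, \<open>M7\<close>; \<open>M8\<close>, \<open>M4\<close>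
  are \<open>1\<close>, \<open>i\<close> times \<open>I\<close>, \<open>R\<close>, \<open>T\<close>, \<open>J\<close>, respectively. So a member of the centralizer unfolding
  is an arbitrary complex matrix \<open>X = z I + a R + b T + c J\<close>, and the reduced family consists of
  the matrices \<open>z I + i t R + e J\<close> with \<open>t\<close> real and \<open>z\<close>, \<open>e\<close> complex.

  A non-scalar \<open>2 \<times> 2\<close> matrix is determined up to similarity by its trace and determinant,
  because any nonzero vector that is not an eigenvector is cyclic and puts the matrix into companion form
  (lemma \<open>similar_if_trace_det_eq\<close>). A scalar \<open>X\<close> already lies in the reduced family. For
  a non-scalar \<open>X\<close>, the trace fixes \<open>z\<close>, and equality of determinants is the single equation
  \<open>t\<^sup>2 + e\<^sup>2 = c\<^sup>2 - a\<^sup>2 - b\<^sup>2\<close>. If the right-hand side is nonzero, \<open>t = 0\<close> and a complex square root \<open>e\<close>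
  will do. If it vanishes, then \<open>X - z I\<close> is a nonzero nilpotent, and \<open>t = 1\<close>, \<open>e = i\<close> supplies a
  nonzero nilpotent in the reduced family; this is the purpose of the parameter of \<open>M6\<close>.
\<close>

section \<open>Matrices commuting with \<open>L\<close> as complex matrices\<close>

definition realify :: "complex^2^2 \<Rightarrow> real^4^4" where
  "realify Z = block (\<chi> i j. Re (Z$i$j)) (\<chi> i j. Im (Z$i$j))
                     (\<chi> i j. - Im (Z$i$j)) (\<chi> i j. Re (Z$i$j))"

definition mat22 :: "'a::zero \<Rightarrow> 'a \<Rightarrow> 'a \<Rightarrow> 'a \<Rightarrow> 'a^2^2" where
  "mat22 p q r s = vector [vector [p, q], vector [r, s]]"

lemma mat22_nth [simp]:
  "mat22 p q r s $ 1 $ 1 = p" "mat22 p q r s $ 1 $ 2 = q"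
  "mat22 p q r s $ 2 $ 1 = r" "mat22 p q r s $ 2 $ 2 = s"
  by (simp_all add: mat22_def)

lemma vector_4 [simp]:
  "(vector [w, x, y, z] :: 'a::zero^4) $ 1 = w" "(vector [w, x, y, z] :: 'a^4) $ 2 = x"
  "(vector [w, x, y, z] :: 'a^4) $ 3 = y" "(vector [w, x, y, z] :: 'a^4) $ 4 = z"
  unfolding vector_def by simp_all

lemma block_nth:
  "block A B C D $ 1 = vector [A$1$1, A$1$2, B$1$1, B$1$2]"
  "block A B C D $ 2 = vector [A$2$1, A$2$2, B$2$1, B$2$2]"
  "block A B C D $ 3 = vector [C$1$1, C$1$2, D$1$1, D$1$2]"
  "block A B C D $ 4 = vector [C$2$1, C$2$2, D$2$1, D$2$2]"
  by (simp_all add: block_def)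

lemma realify_mult: "realify (X ** Y) = realify X ** realify Y"
  by (simp add: vec_eq_iff forall_4 realify_def block_nth matrix_matrix_mult_def sum_4 sum_2
      algebra_simps)

lemma realify_one: "realify (mat 1) = mat 1"
  by (simp add: vec_eq_iff forall_4 realify_def block_nth mat_def)

lemma realify_ii: "realify (mat \<i>) = matL"
  by (simp add: vec_eq_iff forall_4 realify_def block_nth mat_def M5_def)

section \<open>Similarity of two-by-two matrices\<close>

text \<open>
  A non-scalar matrix cannot have both basis vectors and their sum as eigenvectors. One of these
  three is therefore a vector \<open>v\<close> for which \<open>v\<close>, \<open>X v\<close> is a basis, and by the Cayley--Hamilton
  theorem \<open>X\<close> acts on this basis as the companion matrix of its characteristic polynomial.
\<close>

lemma similar_to_companion:
  fixes X :: "'a::field^2^2"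
  assumes "\<nexists>c. X = mat c"
  obtains g where "invertible g" "X ** g = g ** mat22 0 (- det X) 1 (trace X)"
proof -
  \<comment> \<open>The second column is \<open>X\<close> applied to the first, so \<open>(x, y)\<close> must be nonzero and not an eigenvector.\<close>
  obtain x y where xy: "det (mat22 x (X$1$1 * x + X$1$2 * y) y (X$2$1 * x + X$2$2 * y)) \<noteq> 0"
  proof -
    consider "X$2$1 \<noteq> 0" | "X$1$2 \<noteq> 0" | "X$2$1 = 0" "X$1$2 = 0" "X$1$1 \<noteq> X$2$2"
    proof -
      have "X = mat (X$1$1)" if "X$2$1 = 0" "X$1$2 = 0" "X$1$1 = X$2$2"
        using that by (simp add: vec_eq_iff forall_2 mat_def)
      with assms that show thesis by blast
    qed
    then show thesis
    proof cases
      case 1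
      then show thesis by (intro that[of 1 0]) (simp add: det_2)
    next
      case 2
      then show thesis by (intro that[of 0 1]) (simp add: det_2)
    next
      case 3
      then show thesis by (intro that[of 1 1]) (simp add: det_2)
    qed
  qed
  let ?g = "mat22 x (X$1$1 * x + X$1$2 * y) y (X$2$1 * x + X$2$2 * y)"
  have "X ** ?g = ?g ** mat22 0 (- det X) 1 (trace X)"
    by (simp add: vec_eq_iff forall_2 matrix_matrix_mult_def sum_2 det_2 trace_def algebra_simps)
  with xy show thesis
    by (intro that[of ?g]) (simp_all add: invertible_det_nz)
qed

lemma similar_if_trace_det_eq:
  fixes X Y :: "'a::field^2^2"
  assumes "\<nexists>c. X = mat c" "\<nexists>c. Y = mat c" and eq: "trace X = trace Y" "det X = det Y"
  obtains g where "invertible g" "X ** g = g ** Y"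
proof -
  let ?C = "mat22 0 (- det X) 1 (trace X)"
  obtain g where g: "invertible g" "X ** g = g ** ?C"
    using assms(1) similar_to_companion by blast
  obtain h where h: "invertible h" "Y ** h = h ** ?C"
    using assms(2) similar_to_companion[of Y] unfolding eq by blast
  obtain h' where h': "h ** h' = mat 1" "h' ** h = mat 1"
    using h(1) unfolding invertible_def by blast
  have "X ** (g ** h') = g ** ?C ** h'"
    by (simp add: matrix_mul_assoc g(2))
  also have "\<dots> = g ** h' ** (h ** ?C) ** h'"
    by (metis h'(2) matrix_mul_assoc matrix_mul_rid)
  also have "\<dots> = g ** h' ** Y ** (h ** h')"
    by (simp add: matrix_mul_assoc flip: h(2))
  also have "\<dots> = (g ** h') ** Y"
    by (simp add: h')
  finally have "X ** (g ** h') = (g ** h') ** Y" .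
  moreover have "invertible (g ** h')"
    using g(1) h' invertible_def invertible_mult by blast
  ultimately show thesis
    using that by blast
qed

section \<open>The unfolding and its reduction\<close>

text \<open>
  Similarity over the complex numbers becomes equivalence under \<open>Gl_L\<close>: the ring homomorphism
  \<open>realify\<close> preserves inverses, and its values commute with \<open>L\<close> since \<open>i\<close> is central.
\<close>

lemma Gl_L_equivalent_realify:
  assumes "invertible g" and "X ** g = g ** Y"
  shows "Gl_L_equivalent (realify X) (realify Y)"
proof -
  obtain h where h: "g ** h = mat 1" "h ** g = mat 1"
    using assms(1) unfolding invertible_def by blast
  have inv: "invertible (realify g)"
    unfolding invertible_def by (metis h realify_mult realify_one)
  have "g ** mat \<i> = mat \<i> ** g"
    by (simp add: vec_eq_iff forall_2 matrix_matrix_mult_def sum_2 mat_def)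
  then have "realify g \<in> Gl_L"
    using inv unfolding Gl_L_def by (simp flip: realify_ii realify_mult)
  moreover have "matrix_inv (realify g) ** realify X ** realify g
      = matrix_inv (realify g) ** realify g ** realify Y"
    using assms(2) by (metis realify_mult matrix_mul_assoc)
  moreover have "matrix_inv (realify g) ** realify g = mat 1"
    using inv unfolding invertible_def matrix_inv_def by (metis (mono_tags, lifting) someI_ex)
  ultimately show ?thesis
    unfolding Gl_L_equivalent_def by auto
qed

text \<open>
  The matrix on the right is \<open>z I + a R + b T + c J\<close>; the \<open>1\<close> added to the fifth parameter is the
  summand \<open>L\<close> of the unfolding.
\<close>

lemma centralizer_unfolding_eq_realify:
  "centralizer_unfolding \<mu> =
     (let z = Complex (\<mu>$1) (1 + \<mu>$5); a = Complex (\<mu>$2) (\<mu>$6);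
          b = Complex (\<mu>$3) (\<mu>$7); c = Complex (\<mu>$8) (\<mu>$4)
      in realify (mat22 (z + a) (b + c) (b - c) (z - a)))"
  by (simp add: Let_def vec_eq_iff forall_4 realify_def block_nth mat_def centralizer_unfolding_def
      M1_def M2_def M3_def M4_def M5_def M6_def M7_def M8_def matR_def matT_def matJ_def)

definition reduced_parameter :: "real^5 \<Rightarrow> real^8" where
  "reduced_parameter \<nu> = \<nu>$1 *\<^sub>R axis 1 1 + \<nu>$2 *\<^sub>R axis 4 1 + \<nu>$3 *\<^sub>R axis 6 1
     + \<nu>$4 *\<^sub>R axis 8 1 + \<nu>$5 *\<^sub>R axis 5 1"

lemma reduced_parameter_nth [simp]:
  "reduced_parameter \<nu> $ 1 = \<nu>$1" "reduced_parameter \<nu> $ 2 = 0"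
  "reduced_parameter \<nu> $ 3 = 0" "reduced_parameter \<nu> $ 4 = \<nu>$2"
  "reduced_parameter \<nu> $ 5 = \<nu>$5" "reduced_parameter \<nu> $ 6 = \<nu>$3"
  "reduced_parameter \<nu> $ 7 = 0" "reduced_parameter \<nu> $ 8 = \<nu>$4"
  by (simp_all add: reduced_parameter_def axis_def)

lemma UNIV_5: "(UNIV :: 5 set) = {1, 2, 3, 4, 5}"
  by (rule sym, rule card_subset_eq) simp_all

lemma linear_reduced_parameter: "linear reduced_parameter"
  by (rule linearI) (simp_all add: reduced_parameter_def algebra_simps)

lemma inj_reduced_parameter: "inj reduced_parameter"
proof (rule injI)
  fix \<nu> \<nu>' assume eq: "reduced_parameter \<nu> = reduced_parameter \<nu>'"
  have "\<nu>$i = \<nu>'$i" if "i \<in> {1, 2, 3, 4, 5}" for i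
    using that eq by (metis empty_iff insert_iff reduced_parameter_nth)
  then show "\<nu> = \<nu>'"
    by (simp add: vec_eq_iff flip: UNIV_5)
qed

lemma L_r_eq: "L_r \<nu> = centralizer_unfolding (reduced_parameter \<nu>)"
  by (simp add: L_r_def centralizer_unfolding_def add_ac)

text \<open>
  The complex numbers \<open>z\<close>, \<open>c\<close> and the real number \<open>t\<close> are free coordinates on the reduced family.
\<close>

lemma realify_normal_form:
  "\<exists>\<nu>. L_r \<nu> = realify (mat22 (z + \<i> * of_real t) c (- c) (z - \<i> * of_real t))"
proof -
  have "\<exists>\<nu>::real^5. \<nu>$1 = Re z \<and> \<nu>$2 = Im c \<and> \<nu>$3 = t \<and> \<nu>$4 = Re c \<and> \<nu>$5 = Im z - 1"
    by (rule exI[of _ "Re z *\<^sub>R axis 1 1 + Im c *\<^sub>R axis 2 1 + t *\<^sub>R axis 3 1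
        + Re c *\<^sub>R axis 4 1 + (Im z - 1) *\<^sub>R axis 5 1"]) (simp add: axis_def)
  then obtain \<nu> :: "real^5" where \<nu>: "\<nu>$1 = Re z" "\<nu>$2 = Im c" "\<nu>$3 = t" "\<nu>$4 = Re c"
      "\<nu>$5 = Im z - 1"
    by blast
  have "Complex 0 t = \<i> * of_real t" "Complex 0 0 = 0"
    by (simp_all add: complex_eq_iff)
  then have "L_r \<nu> = realify (mat22 (z + \<i> * of_real t) c (- c) (z - \<i> * of_real t))"
    by (simp add: L_r_eq centralizer_unfolding_eq_realify \<nu> Let_def)
  then show ?thesis by blast
qed

lemma Gl_L_equivalent_L_r: "\<exists>\<nu>. Gl_L_equivalent (centralizer_unfolding \<mu>) (L_r \<nu>)"
proof -
  define z a b c where zabc: "z = Complex (\<mu>$1) (1 + \<mu>$5)" "a = Complex (\<mu>$2) (\<mu>$6)"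
    "b = Complex (\<mu>$3) (\<mu>$7)" "c = Complex (\<mu>$8) (\<mu>$4)"
  define X where "X = mat22 (z + a) (b + c) (b - c) (z - a)"
  define Y where "Y t e = mat22 (z + \<i> * of_real t) e (- e) (z - \<i> * of_real t)" for t e
  have X: "centralizer_unfolding \<mu> = realify X"
    by (simp add: centralizer_unfolding_eq_realify X_def zabc Let_def)
  have Y: "\<exists>\<nu>. L_r \<nu> = realify (Y t e)" for t e
    unfolding Y_def by (rule realify_normal_form)
  have "\<exists>t e g. invertible g \<and> X ** g = g ** Y t e"
  proof (cases "\<exists>k. X = mat k")
    case True
    then obtain k where "X = mat k" by blast
    then have "z + a = k \<and> b + c = 0 \<and> b = c \<and> z - a = k"
      by (simp only: X_def vec_eq_iff forall_2 mat22_nth) (simp add: mat_def)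
    then have "a = 0" "b = 0" "c = 0"
      unfolding complex_eq_iff by auto
    then have "X = Y 0 0"
      by (simp add: X_def Y_def)
    then show ?thesis
      by (intro exI[of _ 0] exI[of _ "mat 1"]) (simp add: invertible_def)
  next
    case False
    define d where "d = c\<^sup>2 - a\<^sup>2 - b\<^sup>2"
    \<comment> \<open>The condition \<open>e \<noteq> 0\<close> keeps \<open>Y t e\<close> from being scalar; for \<open>d = 0\<close> it forces \<open>t \<noteq> 0\<close>.\<close>
    obtain t e where te: "(of_real t)\<^sup>2 + e\<^sup>2 = d" "e \<noteq> 0"
    proof (cases "d = 0")
      case True
      then show thesis by (intro that[of 1 \<i>]) simp_all
    next
      case False
      then show thesis by (intro that[of 0 "csqrt d"]) simp_all
    qed
    have "\<nexists>k. Y t e = mat k"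
    proof
      assume "\<exists>k. Y t e = mat k"
      then obtain k where "Y t e = mat k" by blast
      then have "Y t e $ 1 $ 2 = (mat k :: complex^2^2) $ 1 $ 2" by simp
      then show False using te(2) by (simp add: Y_def mat_def)
    qed
    moreover have "trace X = trace (Y t e)"
      by (simp add: X_def Y_def trace_def sum_2)
    moreover have "det X = det (Y t e)"
      using te(1) by (simp add: X_def Y_def det_2 d_def power2_eq_square algebra_simps)
    ultimately show ?thesis
      using similar_if_trace_det_eq False by metis
  qed
  then show ?thesis
    using Gl_L_equivalent_realify X Y by metis
qed

theorem proposition4p4:
  shows "reduced_centralizer_unfolding L_r \<and>
    (\<forall>\<mu> :: real^8. \<exists>g\<in>Gl_L. \<exists>\<nu> :: real^5.
       matrix_inv g ** centralizer_unfolding \<mu> ** g = L_r \<nu>)"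
proof
  show "reduced_centralizer_unfolding L_r"
    unfolding reduced_centralizer_unfolding_def
    using linear_reduced_parameter inj_reduced_parameter L_r_eq Gl_L_equivalent_L_r by auto
  show "\<forall>\<mu> :: real^8. \<exists>g\<in>Gl_L. \<exists>\<nu> :: real^5.
       matrix_inv g ** centralizer_unfolding \<mu> ** g = L_r \<nu>"
    using Gl_L_equivalent_L_r unfolding Gl_L_equivalent_def by metis
qed

end
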